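(* Let $\mathcal{U}$, $\mathcal{V}$, $\mathcal{W}$ be normed vector spaces over $\mathbb{C}$ with $\dim(\mathcal{V})\le\dim(\mathcal{W})\le\dim(\mathcal{U})+\dim(\mathcal{V})<\infty$, where $\mathcal{V}$ and $\mathcal{W}$ are isometrically isomorphic to $\mathbb{C}^{\dim(\mathcal{V})}$ and $\mathbb{C}^{\dim(\mathcal{W})}$ respectively. Let $\Pi\subset\mathcal{U}$ be a complex analytic manifold, let $\mathbf{u}_0\in\Pi$, and let $(\mathbf{u},\mathbf{v})\mapsto\mathbf{f}(\mathbf{u},\mathbf{v})$ be a holomorphic mapping from an open domain $\Omega\subset\mathcal{U}\times\mathcal{V}$ to $\mathcal{W}$ satisfying the following conditions: (i) There is a $\mathbf{v}_0\in\mathcal{V}$ such that $\mathbf{f}(\mathbf{u}_0,\mathbf{v}_0)=\mathbf{0}$. (ii) $\mathbf{f}_{\mathbf{u}\mathbf{v}}(\mathbf{u}_0,\mathbf{v}_0)$ is surjective and $\mathbf{f}_{\mathbf{v}}(\mathbf{u}_0,\mathbf{v}_0)$ is injective. (iii) $\mathbf{f}(\mathbf{u},\mathbf{v})=\mathbf{0}$ implies $\mathbf{u}\in\Pi$. (iv) For every open neighborhood $\Delta$ of $\mathbf{v}_0$ in $\mathcal{V}$, there is an open neighborhood $\Sigma$ of $\mathbf{u}_0$ in $\mathcal{U}$ such that every $\mathbf{u}\in\Sigma\cap\Pi$ corresponds to a unique $\mathbf{v}\in\Delta$ with $\mathbf{f}(\mathbf{u},\mathbf{v})=\mathbf{0}$.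 Then there is an open neighborhood $\Omega_0$ of $\mathbf{u}_0$ in $\mathcal{U}$ such that, for every fixed parameter $\mathbf{u}_1\in\Omega_0\cap\Pi$, the equation $\mathbf{f}(\mathbf{u}_1,\mathbf{v})=\mathbf{0}$ has a unique solution $\mathbf{v}=\mathbf{v}_1\in\mathcal{V}$ and $$\|\mathbf{v}_1-\mathbf{v}_0\|\le\|\mathbf{f}_{\mathbf{v}}(\mathbf{u}_0,\mathbf{v}_0)^\dagger\|\,\|\mathbf{f}_{\mathbf{u}}(\mathbf{u}_0,\mathbf{v}_0)\|\,\|\mathbf{u}_1-\mathbf{u}_0\|+o(\|\mathbf{u}_1-\mathbf{u}_0\|).$$
   Context: $\mathbb{C}^k$ carries the Euclidean norm; isometrically isomorphic means there is a norm-preserving linear isomorphism. Norms of linear transformations are operator norms. The $o(\cdot)$ term is as $\mathbf{u}_1\to\mathbf{u}_0$ in $\Pi$. A mapping from an open subset of a finite-dimensional complex vector space to another is holomorphic if its coordinate representation is holomorphic. A mapping on a non-open set $S$ is holomorphic if it is the restriction to $S$ of a holomorphic mapping defined on an open set containing $S$. Complex analytic manifold: a subset $\Pi$ of a finite-dimensional normed vector space $\mathcal{U}$ over $\mathbb{C}$ is a complex analytic manifold of dimension $m$ if there is an $m$-dimensional normed vector space $\mathcal{X}$ over $\mathbb{C}$ and, for every $\mathbf{u}\in\Pi$, there is an open neighborhood $\Sigma$ of $\mathbf{u}$ in $\mathcal{U}$ and a holomorphic mapping $\phi$ from $\Sigma\cap\Pi$ onto an open subset $\Lambda$ of $\mathcal{X}$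 with a holomorphic inverse. $\mathbf{f}_{\mathbf{u}\mathbf{v}}(\mathbf{u}_0,\mathbf{v}_0):\mathcal{U}\times\mathcal{V}\to\mathcal{W}$ is the Jacobian (complex derivative, a linear transformation) of $\mathbf{f}$, and $\mathbf{f}_{\mathbf{u}}(\mathbf{u}_0,\mathbf{v}_0):\mathcal{U}\to\mathcal{W}$, $\mathbf{f}_{\mathbf{v}}(\mathbf{u}_0,\mathbf{v}_0):\mathcal{V}\to\mathcal{W}$ are its partial Jacobians. $\mathbf{f}_{\mathbf{v}}(\mathbf{u}_0,\mathbf{v}_0)^\dagger:\mathcal{W}\to\mathcal{V}$ is the Moore-Penrose inverse, defined through the isometric isomorphisms of $\mathcal{V},\mathcal{W}$ with $\mathbb{C}^{\dim(\mathcal{V})},\mathbb{C}^{\dim(\mathcal{W})}$ from the Moore-Penrose inverse of the representing matrix. Statements such as $\mathbf{f}(\mathbf{u},\mathbf{v})=\mathbf{0}$ are understood to include $(\mathbf{u},\mathbf{v})\in\Omega$. *)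

theory Defs
  imports
    "HOL-Analysis.Analysis"
    "HOL-Library.Landau_Symbols"
    "Jordan_Normal_Form.Schur_Decomposition"
begin

no_notation Finite_Cartesian_Product.vec_nth (infixl \<open>$\<close> 90)

class scaleC =
  fixes scaleC :: "complex \<Rightarrow> 'a \<Rightarrow> 'a" (infixr "*\<^sub>C" 75)

class complex_vector = real_vector + scaleC +
  assumes scaleC_add_right: "a *\<^sub>C (x + y) = a *\<^sub>C x + a *\<^sub>C y"
    and scaleC_add_left: "(a + b) *\<^sub>C x = a *\<^sub>C x + b *\<^sub>C x"
    and scaleC_scaleC: "a *\<^sub>C (b *\<^sub>C x) = (a * b) *\<^sub>C x"
    and scaleC_one: "1 *\<^sub>C x = x"
    and scaleR_scaleC: "r *\<^sub>R x = complex_of_real r *\<^sub>C x"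

class complex_normed_vector = complex_vector + real_normed_vector +
  assumes norm_scaleC: "norm (a *\<^sub>C x) = cmod a * norm x"

global_interpretation complex_vector:
  vector_space "scaleC :: complex \<Rightarrow> 'a \<Rightarrow> 'a::complex_vector"
  by unfold_locales (simp_all add: scaleC_add_right scaleC_add_left scaleC_scaleC scaleC_one)

instantiation prod :: (complex_vector, complex_vector) complex_vector
begin

definition scaleC_prod :: "complex \<Rightarrow> 'a \<times> 'b \<Rightarrow> 'a \<times> 'b"
  where "scaleC_prod a p = (a *\<^sub>C fst p, a *\<^sub>C snd p)"

instance
  by standard
    (simp_all add: scaleC_prod_def scaleC_add_right scaleC_add_left scaleC_scaleC scaleC_one
      prod_eq_iff scaleR_scaleC)

end

(* The norm on the product is the library's Euclidean combination of the two norms. In finite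
   dimension the topology, and hence openness and holomorphy, do not depend on this choice. *)
instance prod :: (complex_normed_vector, complex_normed_vector) complex_normed_vector
proof
  fix a :: complex and x :: "'a \<times> 'b"
  show "norm (a *\<^sub>C x) = cmod a * norm x"
    by (simp add: norm_prod_def scaleC_prod_def norm_scaleC power_mult_distrib
        real_sqrt_mult flip: distrib_left)
qed

(* dim of a space without a finite basis is 0, so finiteness is always stated separately. *)
definition finite_cdim :: "'a::complex_vector itself \<Rightarrow> bool"
  where "finite_cdim _ \<longleftrightarrow> (\<exists>B::'a set. finite B \<and> complex_vector.span B = UNIV)"

definition cdim :: "'a::complex_vector itself \<Rightarrow> nat"
  where "cdim _ = complex_vector.dim (UNIV :: 'a set)"

(* complex^n is the carrier_vec n of complex vectors *)
definition vnorm :: "complex vec \<Rightarrow> real"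
  where "vnorm z = L2_set (\<lambda>i. cmod (z $ i)) {..<dim_vec z}"

definition linear_coords :: "nat \<Rightarrow> ('a::complex_vector \<Rightarrow> complex vec) \<Rightarrow> bool"
  where "linear_coords n \<phi> \<longleftrightarrow>
    bij_betw \<phi> UNIV (carrier_vec n) \<and>
    (\<forall>x y. \<phi> (x + y) = \<phi> x + \<phi> y) \<and>
    (\<forall>a x. \<phi> (a *\<^sub>C x) = a \<cdot>\<^sub>v \<phi> x)"

definition isometric_coords :: "nat \<Rightarrow> ('a::complex_normed_vector \<Rightarrow> complex vec) \<Rightarrow> bool"
  where "isometric_coords n \<phi> \<longleftrightarrow> linear_coords n \<phi> \<and> (\<forall>x. vnorm (\<phi> x) = norm x)"

(* Holomorphy of F on a relatively open D \<subseteq> carrier_vec n with values in carrier_vec m: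
   complex (total) differentiability at every point, A being the complex Jacobian matrix. *)
definition holomorphic_vec ::
    "nat \<Rightarrow> nat \<Rightarrow> (complex vec \<Rightarrow> complex vec) \<Rightarrow> complex vec set \<Rightarrow> bool"
  where "holomorphic_vec n m F D \<longleftrightarrow>
    (\<forall>a\<in>D. \<exists>A\<in>carrier_mat m n. \<forall>\<epsilon>>0. \<exists>\<delta>>0. \<forall>z\<in>D. vnorm (z - a) < \<delta> \<longrightarrow>
       vnorm (F z - F a - A *\<^sub>v (z - a)) \<le> \<epsilon> * vnorm (z - a))"

definition holomorphic_open ::
    "('a::complex_normed_vector \<Rightarrow> 'b::complex_normed_vector) \<Rightarrow> 'a set \<Rightarrow> bool"
  where "holomorphic_open f S \<longleftrightarrow> open S \<and>
    (\<exists>n m \<phi> \<psi>. linear_coords n \<phi> \<and> linear_coords m \<psi> \<and>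
       holomorphic_vec n m (\<psi> \<circ> f \<circ> inv_into UNIV \<phi>) (\<phi> ` S))"

definition holomorphic_set ::
    "('a::complex_normed_vector \<Rightarrow> 'b::complex_normed_vector) \<Rightarrow> 'a set \<Rightarrow> bool"
  where "holomorphic_set f S \<longleftrightarrow>
    (\<exists>T g. S \<subseteq> T \<and> holomorphic_open g T \<and> (\<forall>x\<in>S. g x = f x))"

(* The model space of the manifold is the type argument 'x, since a space cannot be
   quantified existentially inside a formula. *)
definition complex_analytic_manifold ::
    "'x::complex_normed_vector itself \<Rightarrow> nat \<Rightarrow> 'u::complex_normed_vector set \<Rightarrow> bool"
  where "complex_analytic_manifold X m M \<longleftrightarrow>
    finite_cdim X \<and> cdim X = m \<and>
    (\<forall>u\<in>M. \<exists>N (L :: 'x set) \<phi>.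
       open N \<and> u \<in> N \<and> open L \<and>
       bij_betw \<phi> (N \<inter> M) L \<and>
       holomorphic_set \<phi> (N \<inter> M) \<and>
       holomorphic_open (inv_into (N \<inter> M) \<phi>) L)"

(* Jacobians as linear transformations: for complex differentiable f the real Frechet
   derivative is complex linear, so it is the complex derivative. *)
definition total_jacobian ::
    "('u::real_normed_vector \<times> 'v::real_normed_vector \<Rightarrow> 'w::real_normed_vector) \<Rightarrow>
      'u \<Rightarrow> 'v \<Rightarrow> 'u \<times> 'v \<Rightarrow> 'w"
  where "total_jacobian f u v = frechet_derivative f (at (u, v))"

definition jacobian_fst ::
    "('u::real_normed_vector \<times> 'v::real_normed_vector \<Rightarrow> 'w::real_normed_vector) \<Rightarrow>
      'u \<Rightarrow> 'v \<Rightarrow> 'u \<Rightarrow> 'w"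
  where "jacobian_fst f u v = frechet_derivative (\<lambda>u'. f (u', v)) (at u)"

definition jacobian_snd ::
    "('u::real_normed_vector \<times> 'v::real_normed_vector \<Rightarrow> 'w::real_normed_vector) \<Rightarrow>
      'u \<Rightarrow> 'v \<Rightarrow> 'v \<Rightarrow> 'w"
  where "jacobian_snd f u v = frechet_derivative (\<lambda>v'. f (u, v')) (at v)"

definition is_moore_penrose :: "complex mat \<Rightarrow> complex mat \<Rightarrow> bool"
  where "is_moore_penrose A X \<longleftrightarrow>
    X \<in> carrier_mat (dim_col A) (dim_row A) \<and>
    A * X * A = A \<and> X * A * X = X \<and>
    mat_adjoint (A * X) = A * X \<and> mat_adjoint (X * A) = X * A"

definition mat_pinv :: "complex mat \<Rightarrow> complex mat"
  where "mat_pinv A = (THE X. is_moore_penrose A X)"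

definition repr_mat ::
    "nat \<Rightarrow> nat \<Rightarrow> ('v \<Rightarrow> complex vec) \<Rightarrow> ('w \<Rightarrow> complex vec) \<Rightarrow> ('v \<Rightarrow> 'w) \<Rightarrow> complex mat"
  where "repr_mat n m \<phi> \<psi> L = mat m n (\<lambda>(i, j). \<psi> (L (inv_into UNIV \<phi> (unit_vec n j))) $ i)"

definition map_pinv ::
    "('v::complex_normed_vector \<Rightarrow> complex vec) \<Rightarrow> ('w::complex_normed_vector \<Rightarrow> complex vec) \<Rightarrow>
      ('v \<Rightarrow> 'w) \<Rightarrow> 'w \<Rightarrow> 'v"
  where "map_pinv \<phi> \<psi> L =
    (\<lambda>w. inv_into UNIV \<phi> (mat_pinv (repr_mat (cdim TYPE('v)) (cdim TYPE('w)) \<phi> \<psi> L) *\<^sub>v \<psi> w))"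

end

theory Submission
  imports Defs
begin

text \<open>
  Condition (iv) does the topological work. Taking the whole space \<open>\<V>\<close> as the neighborhood
  \<open>\<Delta>\<close> gives, for every \<open>u\<close> of the manifold near \<open>u\<^sub>0\<close>, a globally unique solution
  \<open>v u\<close>; taking small balls around \<open>v\<^sub>0\<close> shows that this solution tends to \<open>v\<^sub>0\<close>
  as \<open>u\<close> tends to \<open>u\<^sub>0\<close>, because the solution found in the ball must be the global one.

  The rest is linearization. Put \<open>x = u - u\<^sub>0\<close> and \<open>y = v u - v\<^sub>0\<close>. Since \<open>f\<close> vanishes at
  both points, \<open>f\<^sub>u x + f\<^sub>v y = o(\<parallel>x\<parallel> + \<parallel>y\<parallel>)\<close>. The Moore-Penrose inverse \<open>P\<close> of the
  injective map \<open>f\<^sub>v\<close> is a left inverse (\<open>map_pinv_left_inverse\<close>), so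
  \<open>y = - P (f\<^sub>u x) + o(\<parallel>x\<parallel> + \<parallel>y\<parallel>)\<close>. The part of the error proportional to \<open>\<parallel>y\<parallel>\<close>
  is absorbed on the left, which first gives \<open>\<parallel>y\<parallel> = O(\<parallel>x\<parallel>)\<close> and then
  \<open>\<parallel>y\<parallel> \<le> \<parallel>P\<parallel> \<parallel>f\<^sub>u\<parallel> \<parallel>x\<parallel> + o(\<parallel>x\<parallel>)\<close> (\<open>solution_branch_estimate\<close>).

  Two bridges connect this argument with the coordinate definitions. Holomorphy is
  differentiability of a coordinate representation with respect to the Euclidean norm; it becomes
  Frechet differentiability, with a complex linear derivative, because every linear coordinate map
  on a finite-dimensional normed space is bounded in both directions
  (\<open>vnorm_linear_coords_le\<close>, \<open>clinear_vnorm_bound\<close>). Complex linearity is what makes the matrix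
  of \<open>f\<^sub>v\<close> represent \<open>f\<^sub>v\<close>, so that injectivity of the map is injectivity of the matrix.
\<close>

section \<open>The Moore-Penrose inverse of an injective matrix\<close>

lemma mat_adjoint_carrier: "A \<in> carrier_mat m n \<Longrightarrow> mat_adjoint A \<in> carrier_mat n m"
  unfolding mat_adjoint_def by auto

lemma index_mat_adjoint:
  assumes "i < dim_col A" "j < dim_row A"
  shows "mat_adjoint A $$ (i, j) = conjugate (A $$ (j, i))"
  using assms unfolding mat_adjoint_def by (simp add: mat_of_rows_index)

lemma mat_adjoint_mat_adjoint: "mat_adjoint (mat_adjoint A) = (A :: complex mat)"
  by (rule eq_matI) (auto simp: index_mat_adjoint mat_adjoint_def[of "_ :: complex mat"] mat_of_rows_index)

lemma mat_adjoint_mult: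
  fixes A B :: "complex mat"
  assumes A: "A \<in> carrier_mat k m" and B: "B \<in> carrier_mat m n"
  shows "mat_adjoint (A * B) = mat_adjoint B * mat_adjoint A"
proof (rule eq_matI)
  note C = mat_adjoint_carrier[OF A] mat_adjoint_carrier[OF B]
    mat_adjoint_carrier[OF mult_carrier_mat[OF A B]]
  show "dim_row (mat_adjoint (A * B)) = dim_row (mat_adjoint B * mat_adjoint A)"
    and "dim_col (mat_adjoint (A * B)) = dim_col (mat_adjoint B * mat_adjoint A)"
    using C by auto
  fix i j assume "i < dim_row (mat_adjoint B * mat_adjoint A)"
    "j < dim_col (mat_adjoint B * mat_adjoint A)"
  then have ij: "i < n" "j < k" using C by auto
  have "mat_adjoint (A * B) $$ (i, j) = cnj ((A * B) $$ (j, i))"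
    using A B ij by (subst index_mat_adjoint) auto
  also have "\<dots> = (\<Sum>l<m. cnj (A $$ (j, l)) * cnj (B $$ (l, i)))"
    using A B ij by (simp add: scalar_prod_def atLeast0LessThan)
  also have "\<dots> = (\<Sum>l<m. mat_adjoint B $$ (i, l) * mat_adjoint A $$ (l, j))"
    using A B ij by (intro sum.cong) (auto simp: index_mat_adjoint)
  also have "\<dots> = (mat_adjoint B * mat_adjoint A) $$ (i, j)"
    using C ij by (simp add: scalar_prod_def atLeast0LessThan)
  finally show "mat_adjoint (A * B) $$ (i, j) = (mat_adjoint B * mat_adjoint A) $$ (i, j)" .
qed

lemma mat_adjoint_one: "mat_adjoint (1\<^sub>m n) = (1\<^sub>m n :: complex mat)"
  by (rule eq_matI) (auto simp: index_mat_adjoint mat_adjoint_def[of "1\<^sub>m n"] mat_of_rows_index)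

lemma mat_adjoint_scalar_prod:
  fixes A :: "complex mat"
  assumes A: "A \<in> carrier_mat m n" and x: "x \<in> carrier_vec n" and y: "y \<in> carrier_vec m"
  shows "(mat_adjoint A *\<^sub>v y) \<bullet>c x = y \<bullet>c (A *\<^sub>v x)"
proof -
  note C = mat_adjoint_carrier[OF A]
  have "(mat_adjoint A *\<^sub>v y) \<bullet>c x = (\<Sum>i<n. (\<Sum>j<m. cnj (A $$ (j, i)) * y $ j) * cnj (x $ i))"
    using A C x y by (auto simp: scalar_prod_def atLeast0LessThan index_mat_adjoint intro!: sum.cong)
  also have "\<dots> = (\<Sum>j<m. y $ j * (\<Sum>i<n. cnj (A $$ (j, i)) * cnj (x $ i)))"
    unfolding sum_distrib_left sum_distrib_right
    by (subst sum.swap) (simp add: ac_simps)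
  also have "\<dots> = y \<bullet>c (A *\<^sub>v x)"
    using A x y by (auto simp: scalar_prod_def atLeast0LessThan intro!: sum.cong)
  finally show ?thesis .
qed

text \<open>
  Both \<open>A X\<close> and \<open>A Y\<close> are the orthogonal projection onto the range of \<open>A\<close>: from
  \<open>A X = (A Y) (A X)\<close> the adjoint gives \<open>A X = (A X) (A Y) = A Y\<close>. In the same way
  \<open>X A = Y A\<close>, and then \<open>X = X A X = X A Y = Y A Y = Y\<close>.
\<close>
lemma is_moore_penrose_unique:
  fixes A :: "complex mat"
  assumes X: "is_moore_penrose A X" and Y: "is_moore_penrose A Y"
  shows "X = Y"
proof -
  define m n where "m = dim_row A" and "n = dim_col A"
  have A: "A \<in> carrier_mat m n" by (simp add: m_def n_def)
  have cX: "X \<in> carrier_mat n m" and cY: "Y \<in> carrier_mat n m"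
    using X Y by (auto simp: is_moore_penrose_def m_def n_def)
  note car = A cX cY mult_carrier_mat[OF A cX] mult_carrier_mat[OF A cY]
    mult_carrier_mat[OF cX A] mult_carrier_mat[OF cY A]
  have AXA: "A * X * A = A" and XAX: "X * A * X = X"
    and AX: "mat_adjoint (A * X) = A * X" and XA: "mat_adjoint (X * A) = X * A"
    and AYA: "A * Y * A = A" and YAY: "Y * A * Y = Y"
    and AY: "mat_adjoint (A * Y) = A * Y" and YA: "mat_adjoint (Y * A) = Y * A"
    using X Y by (auto simp: is_moore_penrose_def)
  have "A * X = A * Y"
  proof -
    have "A * X = (A * Y) * (A * X)"
      using AYA assoc_mult_mat[OF car(5) A cX] by simp
    then have "A * X = (A * X) * (A * Y)"
      using mat_adjoint_mult[OF car(5) car(4)] AX AY by metis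
    also have "\<dots> = A * Y"
      using AXA assoc_mult_mat[OF car(4) A cY] by simp
    finally show ?thesis .
  qed
  moreover have "X * A = Y * A"
  proof -
    have "X * A = (X * A) * (Y * A)"
      using AYA assoc_mult_mat[OF cX A car(7)] assoc_mult_mat[OF A cY A] by simp
    then have "X * A = (Y * A) * (X * A)"
      using mat_adjoint_mult[OF car(6) car(7)] XA YA by metis
    also have "\<dots> = Y * A"
      using AXA assoc_mult_mat[OF cY A car(6)] assoc_mult_mat[OF A cX A] by simp
    finally show ?thesis .
  qed
  ultimately show ?thesis
    using XAX YAY assoc_mult_mat[OF cX A cX] assoc_mult_mat[OF cX A cY] by metis
qed

text \<open>
  For injective \<open>A\<close> the Gram matrix \<open>G = A\<^sup>H A\<close> is invertible, since \<open>G x = 0\<close> implies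
  \<open>\<parallel>A x\<parallel>\<^sup>2 = \<langle>G x, x\<rangle> = 0\<close>. Then \<open>G\<^sup>-\<^sup>1 A\<^sup>H\<close> is a left inverse that satisfies the Penrose
  equations, hence it is the value of the definite description in \<open>mat_pinv\<close>.
\<close>
lemma mat_pinv_injective:
  fixes A :: "complex mat"
  assumes A: "A \<in> carrier_mat m n"
    and inj: "\<And>x. x \<in> carrier_vec n \<Longrightarrow> A *\<^sub>v x = 0\<^sub>v m \<Longrightarrow> x = 0\<^sub>v n"
  shows "mat_pinv A \<in> carrier_mat n m" and "mat_pinv A * A = 1\<^sub>m n"
proof -
  let ?H = "mat_adjoint A"
  note H = mat_adjoint_carrier[OF A]
  define G where "G = ?H * A"
  have G: "G \<in> carrier_mat n n" using H A by (simp add: G_def)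
  have adjG: "mat_adjoint G = G"
    unfolding G_def using mat_adjoint_mult[OF H A] by (simp add: mat_adjoint_mat_adjoint)
  have "det G \<noteq> 0"
  proof
    assume "det G = 0"
    then obtain x where x: "x \<in> carrier_vec n" "x \<noteq> 0\<^sub>v n" and Gx: "G *\<^sub>v x = 0\<^sub>v n"
      using det_0_iff_vec_prod_zero[OF G] by blast
    have Ax: "A *\<^sub>v x \<in> carrier_vec m" using A x by simp
    have "(A *\<^sub>v x) \<bullet>c (A *\<^sub>v x) = (?H *\<^sub>v (A *\<^sub>v x)) \<bullet>c x"
      using mat_adjoint_scalar_prod[OF A x(1) Ax] by simp
    also have "?H *\<^sub>v (A *\<^sub>v x) = 0\<^sub>v n"
      using Gx assoc_mult_mat_vec[OF H A x(1)] by (simp add: G_def)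
    also have "(0\<^sub>v n) \<bullet>c x = 0" using x by (simp add: scalar_prod_def)
    finally have "A *\<^sub>v x = 0\<^sub>v m" using conjugate_square_eq_0_vec[OF Ax] by simp
    then show False using inj x by blast
  qed
  then obtain B where B: "B \<in> carrier_mat n n" and BG: "B * G = 1\<^sub>m n" and GB: "G * B = 1\<^sub>m n"
    using det_non_zero_imp_unit[OF G, of "()"] by (auto simp: Units_def ring_mat_def)
  \<comment> \<open>The inverse of a Hermitian matrix is Hermitian, because its adjoint is a left inverse too.\<close>
  have adjB: "mat_adjoint B = B"
  proof -
    have cB: "mat_adjoint B \<in> carrier_mat n n" using mat_adjoint_carrier[OF B] .
    have "mat_adjoint B * G = 1\<^sub>m n"
      using mat_adjoint_mult[OF G B] GB adjG by (simp add: mat_adjoint_one)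
    then show ?thesis
      using assoc_mult_mat[OF cB G B] GB left_mult_one_mat[OF B] right_mult_one_mat[OF cB] by simp
  qed
  define X where "X = B * ?H"
  have X: "X \<in> carrier_mat n m" using B H by (simp add: X_def)
  have XA: "X * A = 1\<^sub>m n"
    unfolding X_def using assoc_mult_mat[OF B H A] BG by (simp add: G_def)
  have AX: "mat_adjoint (A * X) = A * X"
  proof -
    have "mat_adjoint (A * X) = mat_adjoint X * ?H" by (rule mat_adjoint_mult[OF A X])
    also have "mat_adjoint X = A * B"
      unfolding X_def using mat_adjoint_mult[OF B H] adjB by (simp add: mat_adjoint_mat_adjoint)
    also have "A * B * ?H = A * X" unfolding X_def by (rule assoc_mult_mat[OF A B H])
    finally show ?thesis .
  qed
  have "is_moore_penrose A X"
    unfolding is_moore_penrose_def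
    using A X XA AX assoc_mult_mat[OF A X A] by (simp add: mat_adjoint_one)
  then have "mat_pinv A = X"
    unfolding mat_pinv_def by (blast intro: the_equality is_moore_penrose_unique)
  then show "mat_pinv A \<in> carrier_mat n m" and "mat_pinv A * A = 1\<^sub>m n"
    using X XA by auto
qed

section \<open>Linear coordinates of a normed space\<close>

abbreviation clinear :: "('a::complex_vector \<Rightarrow> 'b::complex_vector) \<Rightarrow> bool"
  where "clinear \<equiv> Vector_Spaces.linear scaleC scaleC"

lemma clinear_iff:
  "clinear L \<longleftrightarrow> (\<forall>x y. L (x + y) = L x + L y) \<and> (\<forall>a x. L (a *\<^sub>C x) = a *\<^sub>C L x)"
  by (simp add: Vector_Spaces.linear_iff complex_vector.vector_space_axioms)

lemma clinear_sum: "clinear L \<Longrightarrow> L (\<Sum>i\<in>I. g i) = (\<Sum>i\<in>I. L (g i))"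
  unfolding Vector_Spaces.linear_iff_module_hom by (rule module_hom.sum)

lemma
  assumes "linear_coords n \<phi>"
  shows linear_coords_carrier: "\<phi> x \<in> carrier_vec n"
    and linear_coords_dim: "dim_vec (\<phi> x) = n"
    and linear_coords_inj: "\<phi> x = \<phi> y \<longleftrightarrow> x = y"
    and linear_coords_inv: "inv_into UNIV \<phi> (\<phi> x) = x"
    and linear_coords_inv_right: "z \<in> carrier_vec n \<Longrightarrow> \<phi> (inv_into UNIV \<phi> z) = z"
    and linear_coords_add: "\<phi> (x + y) = \<phi> x + \<phi> y"
    and linear_coords_scaleC: "\<phi> (a *\<^sub>C x) = a \<cdot>\<^sub>v \<phi> x"
proof -
  have bij: "bij_betw \<phi> UNIV (carrier_vec n)" using assms by (simp add: linear_coords_def)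
  then have inj: "inj \<phi>" and sur: "range \<phi> = carrier_vec n" by (auto simp: bij_betw_def)
  show c: "\<phi> x \<in> carrier_vec n" using sur by blast
  then show "dim_vec (\<phi> x) = n" by simp
  show "\<phi> x = \<phi> y \<longleftrightarrow> x = y" using inj by (auto dest: injD)
  show "inv_into UNIV \<phi> (\<phi> x) = x" using inj by simp
  show "z \<in> carrier_vec n \<Longrightarrow> \<phi> (inv_into UNIV \<phi> z) = z" using sur by (simp add: f_inv_into_f)
  show "\<phi> (x + y) = \<phi> x + \<phi> y" "\<phi> (a *\<^sub>C x) = a \<cdot>\<^sub>v \<phi> x"
    using assms by (auto simp: linear_coords_def)
qed

lemma linear_coords_zero:
  assumes "linear_coords n \<phi>"
  shows "\<phi> 0 = 0\<^sub>v n"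
proof -
  have "\<phi> 0 = 0 \<cdot>\<^sub>v \<phi> 0" using linear_coords_scaleC[OF assms, of 0 0] by simp
  also have "\<dots> = 0\<^sub>v n"
    by (rule eq_vecI) (simp_all add: linear_coords_dim[OF assms])
  finally show ?thesis .
qed

lemma linear_coords_diff:
  assumes "linear_coords n \<phi>"
  shows "\<phi> (x - y) = \<phi> x - \<phi> y"
proof -
  have "\<phi> x = \<phi> (x - y) + \<phi> y" using linear_coords_add[OF assms, of "x - y" y] by simp
  then show ?thesis
    using linear_coords_dim[OF assms] by (auto intro!: eq_vecI)
qed

lemma linear_coords_sum_index:
  assumes "linear_coords n \<phi>" "j < n"
  shows "\<phi> (\<Sum>i\<in>I. g i) $ j = (\<Sum>i\<in>I. \<phi> (g i) $ j)"
  using assms by (induction I rule: infinite_finite_induct)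
    (auto simp: linear_coords_zero linear_coords_add linear_coords_dim)

lemma linear_coords_combination_index:
  assumes "linear_coords n \<phi>" "j < n"
  shows "\<phi> (\<Sum>i<n. p i *\<^sub>C inv_into UNIV \<phi> (unit_vec n i)) $ j = p j"
proof -
  have "\<phi> (\<Sum>i<n. p i *\<^sub>C inv_into UNIV \<phi> (unit_vec n i)) $ j = (\<Sum>i<n. if i = j then p i else 0)"
    unfolding linear_coords_sum_index[OF assms] using assms(2)
    by (intro sum.cong) (auto simp: linear_coords_scaleC[OF assms(1)] linear_coords_inv_right[OF assms(1)])
  then show ?thesis using assms(2) by simp
qed

lemma linear_coords_expansion:
  assumes "linear_coords n \<phi>"
  shows "x = (\<Sum>i<n. \<phi> x $ i *\<^sub>C inv_into UNIV \<phi> (unit_vec n i))"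
  unfolding linear_coords_inj[OF assms, symmetric]
  by (rule eq_vecI) (simp_all add: linear_coords_dim[OF assms] linear_coords_combination_index[OF assms])

lemma cmod_index_le_vnorm: "i < dim_vec z \<Longrightarrow> cmod (z $ i) \<le> vnorm z"
  unfolding vnorm_def by (rule member_le_L2_set) auto

lemma vnorm_nonneg: "0 \<le> vnorm z"
  unfolding vnorm_def by (rule L2_set_nonneg)

lemma bounded_linear_scaleC_left:
  "bounded_linear (\<lambda>a. a *\<^sub>C (x :: 'a::complex_normed_vector))"
  by (rule bounded_linear_intro[where K = "norm x"])
    (simp_all add: scaleC_add_left scaleR_scaleC scaleC_scaleC norm_scaleC scaleR_conv_of_real)

text \<open>
  The nontrivial half of the equivalence of norms in finite dimension. On the Euclidean unit sphere
  of coefficient families the norm of the combination of basis vectors is continuous, and it is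
  positive because coordinates are unique. The sphere is compact, so this norm has a positive lower
  bound \<open>d\<close>, and homogeneity turns it into \<open>d * vnorm (\<phi> x) \<le> norm x\<close>.
\<close>
lemma vnorm_linear_coords_le:
  fixes \<phi> :: "'a::complex_normed_vector \<Rightarrow> complex vec"
  assumes lc: "linear_coords n \<phi>"
  obtains c where "c > 0" "\<And>x. vnorm (\<phi> x) \<le> c * norm x"
proof -
  define comb where "comb p = (\<Sum>i<n. p i *\<^sub>C inv_into UNIV \<phi> (unit_vec n i))" for p
  define nrm where "nrm p = L2_set (\<lambda>i. cmod (p i)) {..<n}" for p
  \<comment> \<open>Coefficients live in the product topology on functions of all natural numbers; pinning the
    indices from \<open>n\<close> on to 0 makes the cube \<open>Q\<close> a product of compact sets.\<close>
  define Q where "Q = (\<Pi>\<^sub>E i\<in>UNIV. if i < n then cball 0 1 else {0 :: complex})"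
  define K where "K = Q \<inter> {p. nrm p = 1}"
  have "compactin (product_topology (\<lambda>_. euclidean) UNIV) Q"
    unfolding Q_def compactin_PiE by auto
  then have "compact Q"
    by (simp add: euclidean_product_topology)
  moreover have "continuous_on UNIV nrm"
    unfolding nrm_def L2_set_def by (intro continuous_intros)
       (auto intro: continuous_on_subset[OF continuous_on_product_coordinates])
  then have "closed {p. nrm p = 1}"
    by (intro closed_Collect_eq continuous_on_const)
  ultimately have compact: "compact K" unfolding K_def by (rule compact_Int_closed)
  have "continuous_on UNIV (\<lambda>p. norm (comb p))"
    unfolding comb_def
    by (intro continuous_on_norm continuous_on_sum
        bounded_linear.continuous_on[OF bounded_linear_scaleC_left]
        continuous_on_product_coordinates)
  then have cont: "continuous_on K (\<lambda>p. norm (comb p))"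
    by (rule continuous_on_subset) simp
  have pos: "norm (comb p) > 0" if "p \<in> K" for p
  proof -
    have "comb p \<noteq> 0"
    proof
      assume "comb p = 0"
      then have "p i = 0" if "i < n" for i
        using linear_coords_combination_index[OF lc that, of p] that
        by (simp add: comb_def linear_coords_zero[OF lc])
      then have "nrm p = 0" by (simp add: nrm_def L2_set_def)
      with \<open>p \<in> K\<close> show False by (simp add: K_def)
    qed
    then show ?thesis by simp
  qed
  obtain d where d: "d > 0" "\<And>p. p \<in> K \<Longrightarrow> d \<le> norm (comb p)"
  proof (cases "K = {}")
    \<comment> \<open>The sphere is empty exactly when \<open>n = 0\<close>.\<close>
    case True
    then show ?thesis using that[of 1] by simp
  next
    case False
    then obtain q where "q \<in> K" "\<And>p. p \<in> K \<Longrightarrow> norm (comb q) \<le> norm (comb p)"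
      using continuous_attains_inf[OF compact _ cont] by blast
    then show ?thesis using that pos by blast
  qed
  have "d * vnorm (\<phi> x) \<le> norm x" for x
  proof (cases "vnorm (\<phi> x) = 0")
    case False
    define t where "t = vnorm (\<phi> x)"
    have t: "t > 0" using False vnorm_nonneg[of "\<phi> x"] by (simp add: t_def)
    define p where "p i = (if i < n then \<phi> x $ i / of_real t else 0)" for i
    have "nrm p = L2_set (\<lambda>i. (1 / t) * cmod (\<phi> x $ i)) {..<n}"
      unfolding nrm_def using t by (intro L2_set_cong) (auto simp: p_def norm_divide)
    also have "\<dots> = (1 / t) * t"
      using t L2_set_right_distrib[of "1 / t" "\<lambda>i. cmod (\<phi> x $ i)" "{..<n}"]
      by (simp add: t_def[unfolded vnorm_def linear_coords_dim[OF lc], symmetric])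
    finally have "nrm p = 1" using t by simp
    moreover have "p \<in> Q"
      using t cmod_index_le_vnorm[of _ "\<phi> x"]
      by (auto simp: Q_def p_def norm_divide t_def linear_coords_dim[OF lc])
    ultimately have "d \<le> norm (comb p)" using d by (simp add: K_def)
    also have "comb p = (1 / of_real t) *\<^sub>C x"
    proof -
      have "comb p = (\<Sum>i<n. (1 / of_real t) *\<^sub>C (\<phi> x $ i *\<^sub>C inv_into UNIV \<phi> (unit_vec n i)))"
        unfolding comb_def by (intro sum.cong) (auto simp: p_def scaleC_scaleC)
      also have "\<dots> = (1 / of_real t) *\<^sub>C x"
        unfolding complex_vector.scale_sum_right[symmetric]
        by (rule arg_cong[OF linear_coords_expansion[OF lc, symmetric]])
      finally show ?thesis .
    qed
    also have "norm \<dots> = norm x / t" using t by (simp add: norm_scaleC norm_divide)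
    finally show ?thesis using t by (simp add: t_def field_simps)
  qed auto
  then have "vnorm (\<phi> x) \<le> (1 / d) * norm x" for x
    using d(1) by (simp add: field_simps)
  then show ?thesis using that[of "1 / d"] d(1) by simp
qed

text \<open>
  With the identity as \<open>L\<close> this is the other half of the equivalence of norms; for general
  \<open>L\<close> it shows that linear maps on a finite-dimensional space are bounded.
\<close>
lemma clinear_vnorm_bound:
  fixes \<phi> :: "'a::complex_vector \<Rightarrow> complex vec" and L :: "'a \<Rightarrow> 'b::complex_normed_vector"
  assumes lc: "linear_coords n \<phi>" and L: "clinear L"
  obtains C where "C > 0" "\<And>x. norm (L x) \<le> C * vnorm (\<phi> x)"
proof
  define b where "b i = inv_into UNIV \<phi> (unit_vec n i)" for i
  let ?C = "(\<Sum>i<n. norm (L (b i))) + 1"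
  have nonneg: "0 \<le> (\<Sum>i<n. norm (L (b i)))" by (simp add: sum_nonneg)
  then show "?C > 0" by simp
  fix x
  have "L x = L (\<Sum>i<n. \<phi> x $ i *\<^sub>C b i)"
    unfolding b_def using linear_coords_expansion[OF lc, of x] by simp
  also have "\<dots> = (\<Sum>i<n. \<phi> x $ i *\<^sub>C L (b i))"
    using L by (simp add: clinear_sum clinear_iff)
  finally have "norm (L x) \<le> (\<Sum>i<n. norm (\<phi> x $ i *\<^sub>C L (b i)))"
    by (simp add: norm_sum)
  also have "\<dots> \<le> (\<Sum>i<n. vnorm (\<phi> x) * norm (L (b i)))"
    unfolding norm_scaleC
    by (intro sum_mono mult_right_mono cmod_index_le_vnorm) (auto simp: linear_coords_dim[OF lc])
  also have "\<dots> \<le> ?C * vnorm (\<phi> x)"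
    by (simp add: sum_distrib_left[symmetric] algebra_simps vnorm_nonneg)
  finally show "norm (L x) \<le> ?C * vnorm (\<phi> x)" .
qed

lemma clinear_bounded_linear:
  fixes \<phi> :: "'a::complex_normed_vector \<Rightarrow> complex vec"
    and L :: "'a \<Rightarrow> 'b::complex_normed_vector"
  assumes lc: "linear_coords n \<phi>" and L: "clinear L"
  shows "bounded_linear L"
proof -
  obtain C where C: "C > 0" "\<And>x. norm (L x) \<le> C * vnorm (\<phi> x)"
    using clinear_vnorm_bound[OF lc L] by blast
  obtain c where c: "c > 0" "\<And>x. vnorm (\<phi> x) \<le> c * norm x"
    using vnorm_linear_coords_le[OF lc] by blast
  show ?thesis
  proof (rule bounded_linear_intro[where K = "C * c"])
    show "L (x + y) = L x + L y" for x y using L by (simp add: clinear_iff)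
    show "L (r *\<^sub>R x) = r *\<^sub>R L x" for r x using L by (simp add: clinear_iff scaleR_scaleC)
    show "norm (L x) \<le> norm x * (C * c)" for x
      using order_trans[OF C(2)[of x] mult_left_mono[OF c(2)[of x]]] C(1)
      by (simp add: algebra_simps)
  qed
qed

lemma clinear_mat_coords:
  assumes lc: "linear_coords n \<phi>" and lc': "linear_coords m \<psi>" and A: "A \<in> carrier_mat m n"
  shows "clinear (\<lambda>x. inv_into UNIV \<psi> (A *\<^sub>v \<phi> x))"
    and "\<psi> (inv_into UNIV \<psi> (A *\<^sub>v \<phi> x)) = A *\<^sub>v \<phi> x"
proof -
  note car = linear_coords_carrier[OF lc]
  have inv: "\<psi> (inv_into UNIV \<psi> (A *\<^sub>v \<phi> x)) = A *\<^sub>v \<phi> x" for x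
    by (rule linear_coords_inv_right[OF lc' mult_mat_vec_carrier[OF A car]])
  then show "\<psi> (inv_into UNIV \<psi> (A *\<^sub>v \<phi> x)) = A *\<^sub>v \<phi> x" .
  show "clinear (\<lambda>x. inv_into UNIV \<psi> (A *\<^sub>v \<phi> x))"
    unfolding clinear_iff linear_coords_inj[OF lc', symmetric]
    by (simp add: linear_coords_inv_right[OF lc'] mult_mat_vec_carrier[OF A car]
        linear_coords_add[OF lc'] linear_coords_scaleC[OF lc']
        linear_coords_add[OF lc] linear_coords_scaleC[OF lc]
        mult_add_distrib_mat_vec[OF A car car] mult_mat_vec[OF A car])
qed

text \<open>
  The columns of \<open>repr_mat\<close> are the images of the basis vectors; that they determine \<open>L\<close>
  requires homogeneity over the complex numbers, not only over the reals.
\<close>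
lemma repr_mat_mult:
  assumes lc: "linear_coords n \<phi>" and lc': "linear_coords m \<psi>" and L: "clinear L"
  shows "repr_mat n m \<phi> \<psi> L *\<^sub>v \<phi> x = \<psi> (L x)"
proof (rule eq_vecI)
  let ?b = "\<lambda>i. inv_into UNIV \<phi> (unit_vec n i)"
  show "dim_vec (repr_mat n m \<phi> \<psi> L *\<^sub>v \<phi> x) = dim_vec (\<psi> (L x))"
    by (simp add: repr_mat_def linear_coords_dim[OF lc'])
  fix j assume "j < dim_vec (\<psi> (L x))"
  then have j: "j < m" by (simp add: linear_coords_dim[OF lc'])
  have "L x = L (\<Sum>i<n. \<phi> x $ i *\<^sub>C ?b i)"
    using linear_coords_expansion[OF lc, of x] by simp
  also have "\<dots> = (\<Sum>i<n. \<phi> x $ i *\<^sub>C L (?b i))"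
    using L by (simp add: clinear_sum clinear_iff)
  finally have "\<psi> (L x) $ j = (\<Sum>i<n. \<psi> (\<phi> x $ i *\<^sub>C L (?b i)) $ j)"
    by (simp add: linear_coords_sum_index[OF lc' j])
  also have "\<dots> = (\<Sum>i<n. \<psi> (L (?b i)) $ j * \<phi> x $ i)"
    using j by (simp add: linear_coords_scaleC[OF lc'] linear_coords_dim[OF lc'] mult.commute)
  also have "\<dots> = (repr_mat n m \<phi> \<psi> L *\<^sub>v \<phi> x) $ j"
    using j by (simp add: repr_mat_def scalar_prod_def atLeast0LessThan linear_coords_dim[OF lc])
  finally show "(repr_mat n m \<phi> \<psi> L *\<^sub>v \<phi> x) $ j = \<psi> (L x) $ j" by simp
qed

lemma map_pinv_left_inverse:
  fixes \<phi> :: "'v::complex_normed_vector \<Rightarrow> complex vec"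
    and \<psi> :: "'w::complex_normed_vector \<Rightarrow> complex vec" and L :: "'v \<Rightarrow> 'w"
  assumes lc: "linear_coords (cdim TYPE('v)) \<phi>" and lc': "linear_coords (cdim TYPE('w)) \<psi>"
    and L: "clinear L" and "inj L"
  shows "clinear (map_pinv \<phi> \<psi> L)" and "map_pinv \<phi> \<psi> L (L y) = y"
proof -
  define n m where "n = cdim TYPE('v)" and "m = cdim TYPE('w)"
  note lc = lc[folded n_def] and lc' = lc'[folded m_def]
  define A where "A = repr_mat n m \<phi> \<psi> L"
  have A: "A \<in> carrier_mat m n" by (simp add: A_def repr_mat_def)
  have A_eq: "A *\<^sub>v \<phi> x = \<psi> (L x)" for x
    unfolding A_def by (rule repr_mat_mult[OF lc lc' L])
  have L0: "L 0 = 0"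
    using L clinear_iff[of L] by (metis add_cancel_right_right)
  have "z = 0\<^sub>v n" if z: "z \<in> carrier_vec n" "A *\<^sub>v z = 0\<^sub>v m" for z
  proof -
    have "\<psi> (L (inv_into UNIV \<phi> z)) = \<psi> (L 0)"
      using A_eq[of "inv_into UNIV \<phi> z"] z
      by (simp add: linear_coords_inv_right[OF lc] L0 linear_coords_zero[OF lc'])
    then have "inv_into UNIV \<phi> z = 0"
      using \<open>inj L\<close> by (simp add: linear_coords_inj[OF lc'] inj_eq)
    then show ?thesis
      using linear_coords_inv_right[OF lc z(1)] linear_coords_zero[OF lc] by simp
  qed
  note P = mat_pinv_injective[OF A this]
  have eq: "map_pinv \<phi> \<psi> L = (\<lambda>w. inv_into UNIV \<phi> (mat_pinv A *\<^sub>v \<psi> w))"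
    by (simp add: map_pinv_def A_def n_def m_def)
  show "clinear (map_pinv \<phi> \<psi> L)"
    unfolding eq by (rule clinear_mat_coords[OF lc' lc P(1)])
  have "mat_pinv A *\<^sub>v \<psi> (L y) = \<phi> y"
    unfolding A_eq[symmetric]
    using assoc_mult_mat_vec[OF P(1) A linear_coords_carrier[OF lc], of y] P(2)
      linear_coords_carrier[OF lc, of y] by simp
  then show "map_pinv \<phi> \<psi> L (L y) = y"
    by (simp add: eq linear_coords_inv[OF lc])
qed

section \<open>The derivative of a holomorphic mapping\<close>

text \<open>
  The derivative is the Jacobian matrix \<open>A\<close> transported back through the coordinates. The
  error in coordinates is small relative to \<open>vnorm (\<phi> (y - a))\<close>, and the two norm
  comparisons, with constants \<open>C\<close> and \<open>c\<close>, make it small relative to \<open>norm (y - a)\<close>.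
\<close>
lemma holomorphic_open_has_derivative:
  fixes f :: "'a::complex_normed_vector \<Rightarrow> 'b::complex_normed_vector"
  assumes hol: "holomorphic_open f S" and a: "a \<in> S"
  obtains D where "(f has_derivative D) (at a)" "clinear D"
proof -
  obtain n m \<phi> \<psi> where opn: "open S"
    and lc: "linear_coords n (\<phi> :: 'a \<Rightarrow> _)" and lc': "linear_coords m (\<psi> :: 'b \<Rightarrow> _)"
    and hv: "holomorphic_vec n m (\<psi> \<circ> f \<circ> inv_into UNIV \<phi>) (\<phi> ` S)"
    using hol unfolding holomorphic_open_def by blast
  obtain A where A: "A \<in> carrier_mat m n"
    and A': "\<forall>\<epsilon>>0. \<exists>\<delta>>0. \<forall>y\<in>S. vnorm (\<phi> y - \<phi> a) < \<delta> \<longrightarrow>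
      vnorm (\<psi> (f y) - \<psi> (f a) - A *\<^sub>v (\<phi> y - \<phi> a)) \<le> \<epsilon> * vnorm (\<phi> y - \<phi> a)"
    using hv a by (auto simp: holomorphic_vec_def linear_coords_inv[OF lc])
  define D where "D x = inv_into UNIV \<psi> (A *\<^sub>v \<phi> x)" for x
  have D: "clinear D" and \<psi>D: "\<psi> (D x) = A *\<^sub>v \<phi> x" for x
    using clinear_mat_coords[OF lc lc' A] by (simp_all add: D_def[abs_def])
  have coord: "\<psi> (f y) - \<psi> (f a) - A *\<^sub>v (\<phi> y - \<phi> a) = \<psi> (f y - f a - D (y - a))" for y
    by (simp add: linear_coords_diff[OF lc'] linear_coords_diff[OF lc] \<psi>D)
  obtain c where c: "c > 0" "\<And>x. vnorm (\<phi> x) \<le> c * norm x"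
    using vnorm_linear_coords_le[OF lc] by blast
  have "clinear (\<lambda>x :: 'b. x)" by (simp add: clinear_iff)
  then obtain C where C: "C > 0" "\<And>x. norm x \<le> C * vnorm (\<psi> x)"
    using clinear_vnorm_bound[OF lc'] by metis
  have "(f has_derivative D) (at a)"
    unfolding has_derivative_at_alt
  proof (intro conjI allI impI)
    show "bounded_linear D" by (rule clinear_bounded_linear[OF lc D])
    fix e :: real assume e: "e > 0"
    then have "e / (C * c) > 0" using C c by simp
    then obtain \<delta> where \<delta>: "\<delta> > 0" "\<And>y. y \<in> S \<Longrightarrow> vnorm (\<phi> (y - a)) < \<delta> \<Longrightarrow>
        vnorm (\<psi> (f y - f a - D (y - a))) \<le> e / (C * c) * vnorm (\<phi> (y - a))"
      using A'[rule_format, of "e / (C * c)"]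
      by (auto simp: coord linear_coords_diff[OF lc])
    obtain s where s: "s > 0" "ball a s \<subseteq> S" using opn a open_contains_ball by blast
    show "\<exists>d>0. \<forall>y. norm (y - a) < d \<longrightarrow> norm (f y - f a - D (y - a)) \<le> e * norm (y - a)"
    proof (intro exI conjI allI impI)
      show "min s (\<delta> / c) > 0" using s \<delta> c by simp
      fix y assume y: "norm (y - a) < min s (\<delta> / c)"
      then have "y \<in> S" using s by (auto simp: dist_norm norm_minus_commute)
      moreover have "vnorm (\<phi> (y - a)) < \<delta>"
      proof -
        have "c * norm (y - a) < \<delta>" using y c by (simp add: field_simps)
        then show ?thesis using c(2)[of "y - a"] by linarith
      qed
      ultimately have
        "vnorm (\<psi> (f y - f a - D (y - a))) \<le> e / (C * c) * vnorm (\<phi> (y - a))" by (rule \<delta>)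
      also have "\<dots> \<le> e / (C * c) * (c * norm (y - a))"
        using e C c by (intro mult_left_mono) auto
      finally have "C * vnorm (\<psi> (f y - f a - D (y - a))) \<le> e * norm (y - a)"
        using C c by (simp add: field_simps)
      then show "norm (f y - f a - D (y - a)) \<le> e * norm (y - a)"
        using C(2) order_trans by blast
    qed
  qed
  then show ?thesis using that D by blast
qed

section \<open>First-order estimate for a solution branch\<close>

text \<open>
  The quantitative form of the linearization. Truncating at 0 makes the remainder small from both
  sides: without it, a branch that moves more slowly than the bound allows would give a remainder
  that is negative of first order.
\<close>
lemma solution_branch_estimate:
  fixes f :: "'u::real_normed_vector \<times> 'v::real_normed_vector \<Rightarrow> 'w::real_normed_vector"
  assumes f: "(f has_derivative D) (at (u\<^sub>0, v\<^sub>0))" and f0: "f (u\<^sub>0, v\<^sub>0) = 0"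
    and P: "bounded_linear P" and left: "\<And>y. P (D (0, y)) = y"
    and v: "(v \<longlongrightarrow> v\<^sub>0) (at u\<^sub>0 within M)"
    and zero: "eventually (\<lambda>u. f (u, v u) = 0) (at u\<^sub>0 within M)"
  shows "(\<lambda>u. max 0 (norm (v u - v\<^sub>0) - onorm P * onorm (\<lambda>x. D (x, 0)) * norm (u - u\<^sub>0)))
    \<in> o[at u\<^sub>0 within M](\<lambda>u. norm (u - u\<^sub>0))"
proof (rule landau_o.smallI)
  fix c :: real assume c: "c > 0"
  have D: "bounded_linear D" using f by (rule has_derivative_bounded_linear)
  have Du: "bounded_linear (\<lambda>x. D (x, 0))"
    using bounded_linear_compose[OF D bounded_linear_Pair[OF bounded_linear_ident bounded_linear_zero]] .
  define B where "B = onorm P"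
  define \<alpha> where "\<alpha> = onorm (\<lambda>x. D (x, 0))"
  have B: "B \<ge> 0" and \<alpha>: "\<alpha> \<ge> 0"
    using onorm_pos_le[OF P] onorm_pos_le[OF Du] by (auto simp: B_def \<alpha>_def)
  \<comment> \<open>Once the error is at most \<open>e (\<parallel>x\<parallel> + \<parallel>y\<parallel>)\<close> with \<open>e \<le> 1/2\<close>, absorbing
    \<open>\<parallel>y\<parallel>\<close> gives \<open>\<parallel>x\<parallel> + \<parallel>y\<parallel> \<le> k \<parallel>x\<parallel>\<close>; the choice \<open>e \<le> c / k\<close> then bounds the
    error by \<open>c \<parallel>x\<parallel>\<close>. Dividing by \<open>B + 1\<close> instead of \<open>B\<close> covers \<open>B = 0\<close>.\<close>
  define k where "k = 2 * (B * \<alpha>) + 2"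
  have k: "k > 0" using B \<alpha> by (simp add: k_def add_nonneg_pos)
  define e where "e = min (1/2) (c / k)"
  have e: "e > 0" "e \<le> 1/2" "e * k \<le> c"
    using c k by (auto simp: e_def min_def field_simps)
  define \<epsilon> where "\<epsilon> = e / (B + 1)"
  have \<epsilon>: "\<epsilon> > 0" "B * \<epsilon> \<le> e" using e B by (auto simp: \<epsilon>_def field_simps)
  obtain d where d: "d > 0" "\<And>p. norm (p - (u\<^sub>0, v\<^sub>0)) < d \<Longrightarrow>
      norm (f p - f (u\<^sub>0, v\<^sub>0) - D (p - (u\<^sub>0, v\<^sub>0))) \<le> \<epsilon> * norm (p - (u\<^sub>0, v\<^sub>0))"
    using f \<epsilon>(1) unfolding has_derivative_at_alt by blast
  have "((\<lambda>u. (u, v u)) \<longlongrightarrow> (u\<^sub>0, v\<^sub>0)) (at u\<^sub>0 within M)"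
    using v by (intro tendsto_Pair tendsto_ident_at)
  then have near: "eventually (\<lambda>u. dist (u, v u) (u\<^sub>0, v\<^sub>0) < d) (at u\<^sub>0 within M)"
    using d(1) by (rule tendstoD)
  show "eventually (\<lambda>u. norm (max 0 (norm (v u - v\<^sub>0) -
      onorm P * onorm (\<lambda>x. D (x, 0)) * norm (u - u\<^sub>0))) \<le> c * norm (norm (u - u\<^sub>0))) (at u\<^sub>0 within M)"
    using near zero
  proof eventually_elim
    case (elim u)
    define x y where "x = u - u\<^sub>0" and "y = v u - v\<^sub>0"
    have Dxy: "D (x, y) = D (x, 0) + D (0, y)"
      using linear_add[OF bounded_linear.linear[OF D], of "(x, 0)" "(0, y)"] by simp
    have "norm (D (x, y)) \<le> \<epsilon> * norm (x, y)"
      using d(2)[of "(u, v u)"] elim f0 by (simp add: dist_norm x_def y_def)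
    also have "\<dots> \<le> \<epsilon> * (norm x + norm y)"
      using \<epsilon> by (intro mult_left_mono norm_Pair_le) auto
    finally have small: "norm (D (x, y)) \<le> \<epsilon> * (norm x + norm y)" .
    have "y = P (D (x, y)) - P (D (x, 0))"
      unfolding Dxy using left linear_add[OF bounded_linear.linear[OF P]] by simp
    then have "norm y \<le> norm (P (D (x, y))) + norm (P (D (x, 0)))"
      by (metis norm_triangle_ineq4)
    also have "norm (P (D (x, y))) \<le> B * norm (D (x, y))"
      unfolding B_def by (rule onorm[OF P])
    also have "\<dots> \<le> B * (\<epsilon> * (norm x + norm y))"
      using small B by (rule mult_left_mono)
    also have "\<dots> = (B * \<epsilon>) * (norm x + norm y)" by simp
    also have "\<dots> \<le> e * (norm x + norm y)"
      using \<epsilon>(2) by (intro mult_right_mono) auto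
    also have "norm (P (D (x, 0))) \<le> B * norm (D (x, 0))"
      unfolding B_def by (rule onorm[OF P])
    also have "\<dots> \<le> B * (\<alpha> * norm x)"
      unfolding \<alpha>_def using onorm[OF Du] B by (intro mult_left_mono) auto
    finally have est: "norm y \<le> e * (norm x + norm y) + B * (\<alpha> * norm x)" by simp
    have "e * (norm x + norm y) \<le> 1/2 * (norm x + norm y)"
      using e by (intro mult_right_mono) auto
    with est have "norm x + norm y \<le> k * norm x"
      by (simp add: k_def algebra_simps)
    then have "e * (norm x + norm y) \<le> e * (k * norm x)"
      using e by (intro mult_left_mono) auto
    also have "\<dots> \<le> c * norm x"
      using mult_right_mono[OF e(3), of "norm x"] by (simp add: mult.assoc)
    finally have "norm y - B * \<alpha> * norm x \<le> c * norm x"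
      using est by (simp add: mult.assoc)
    then show ?case
      using c by (simp add: B_def \<alpha>_def x_def y_def)
  qed
qed

section \<open>Perturbation of the solution\<close>

theorem corollary1:
  fixes f :: "'u::complex_normed_vector \<times> 'v::complex_normed_vector \<Rightarrow> 'w::complex_normed_vector"
    and \<Omega> :: "('u \<times> 'v) set"
    and M :: "'u set"
    and u\<^sub>0 :: 'u and v\<^sub>0 :: 'v
    and \<phi> :: "'v \<Rightarrow> complex vec" and \<psi> :: "'w \<Rightarrow> complex vec"
    and m :: nat
  assumes "finite_cdim TYPE('u)" and "finite_cdim TYPE('v)" and "finite_cdim TYPE('w)"
    and "cdim TYPE('v) \<le> cdim TYPE('w)"
    and "cdim TYPE('w) \<le> cdim TYPE('u) + cdim TYPE('v)"
    and "isometric_coords (cdim TYPE('v)) \<phi>"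
    and "isometric_coords (cdim TYPE('w)) \<psi>"
    and "complex_analytic_manifold TYPE('x::complex_normed_vector) m M"
    and "u\<^sub>0 \<in> M"
    and "open \<Omega>" and "holomorphic_open f \<Omega>"
    and "(u\<^sub>0, v\<^sub>0) \<in> \<Omega>" and "f (u\<^sub>0, v\<^sub>0) = 0"
    and "surj (total_jacobian f u\<^sub>0 v\<^sub>0)" and "inj (jacobian_snd f u\<^sub>0 v\<^sub>0)"
    and "\<And>u v. (u, v) \<in> \<Omega> \<Longrightarrow> f (u, v) = 0 \<Longrightarrow> u \<in> M"
    and "\<And>\<Delta>. open \<Delta> \<Longrightarrow> v\<^sub>0 \<in> \<Delta> \<Longrightarrow>
           \<exists>N. open N \<and> u\<^sub>0 \<in> N \<and>
             (\<forall>u\<in>N \<inter> M. \<exists>!v. v \<in> \<Delta> \<and> (u, v) \<in> \<Omega> \<and> f (u, v) = 0)"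
  shows "\<exists>\<Omega>\<^sub>0 r. open \<Omega>\<^sub>0 \<and> u\<^sub>0 \<in> \<Omega>\<^sub>0 \<and>
           r \<in> o[at u\<^sub>0 within M](\<lambda>u. norm (u - u\<^sub>0)) \<and>
           (\<forall>u\<^sub>1\<in>\<Omega>\<^sub>0 \<inter> M.
              (\<exists>!v\<^sub>1. (u\<^sub>1, v\<^sub>1) \<in> \<Omega> \<and> f (u\<^sub>1, v\<^sub>1) = 0) \<and>
              (\<forall>v\<^sub>1. (u\<^sub>1, v\<^sub>1) \<in> \<Omega> \<and> f (u\<^sub>1, v\<^sub>1) = 0 \<longrightarrow>
                 norm (v\<^sub>1 - v\<^sub>0) \<le>
                   onorm (map_pinv \<phi> \<psi> (jacobian_snd f u\<^sub>0 v\<^sub>0)) *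
                   onorm (jacobian_fst f u\<^sub>0 v\<^sub>0) * norm (u\<^sub>1 - u\<^sub>0) + r u\<^sub>1))"
proof -
  let ?sol = "\<lambda>u v. (u, v) \<in> \<Omega> \<and> f (u, v) = 0"
  note iv = assms(17)
  have lc: "linear_coords (cdim TYPE('v)) \<phi>" and lc': "linear_coords (cdim TYPE('w)) \<psi>"
    using assms(6,7) by (auto simp: isometric_coords_def)
  obtain D where D: "(f has_derivative D) (at (u\<^sub>0, v\<^sub>0))" "clinear D"
    using holomorphic_open_has_derivative[OF assms(11,12)] by blast
  have Jv: "jacobian_snd f u\<^sub>0 v\<^sub>0 = (\<lambda>y. D (0, y))"
  proof -
    have "((\<lambda>v. f (u\<^sub>0, v)) has_derivative (\<lambda>y. D (0, y))) (at v\<^sub>0)"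
      by (rule has_derivative_compose[of "\<lambda>v. (u\<^sub>0, v)" "\<lambda>y. (0, y)", OF _ D(1)])
        (auto intro!: derivative_eq_intros)
    then show ?thesis unfolding jacobian_snd_def by (rule frechet_derivative_at[symmetric])
  qed
  have Ju: "jacobian_fst f u\<^sub>0 v\<^sub>0 = (\<lambda>x. D (x, 0))"
  proof -
    have "((\<lambda>u. f (u, v\<^sub>0)) has_derivative (\<lambda>x. D (x, 0))) (at u\<^sub>0)"
      by (rule has_derivative_compose[of "\<lambda>u. (u, v\<^sub>0)" "\<lambda>x. (x, 0)", OF _ D(1)])
        (auto intro!: derivative_eq_intros)
    then show ?thesis unfolding jacobian_fst_def by (rule frechet_derivative_at[symmetric])
  qed
  have "D (0, y + y') = D (0, y) + D (0, y')" "D (0, a *\<^sub>C y) = a *\<^sub>C D (0, y)" for y y' a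
  proof -
    have "D ((0, y) + (0, y')) = D (0, y) + D (0, y')" "D (a *\<^sub>C (0, y)) = a *\<^sub>C D (0, y)"
      using D(2) unfolding clinear_iff by blast+
    then show "D (0, y + y') = D (0, y) + D (0, y')" "D (0, a *\<^sub>C y) = a *\<^sub>C D (0, y)"
      by (simp_all add: scaleC_prod_def)
  qed
  then have "clinear (jacobian_snd f u\<^sub>0 v\<^sub>0)"
    unfolding Jv clinear_iff by blast
  note pinv = map_pinv_left_inverse[OF lc lc' this assms(15)]
  define P where "P = map_pinv \<phi> \<psi> (jacobian_snd f u\<^sub>0 v\<^sub>0)"
  have P: "bounded_linear P" "P (D (0, y)) = y" for y
    using clinear_bounded_linear[OF lc' pinv(1)] pinv(2)[of y] by (simp_all add: P_def Jv)

  \<comment> \<open>Existence and uniqueness over the whole space: condition (iv) for the largest neighborhood.\<close>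
  obtain N where N: "open N" "u\<^sub>0 \<in> N" "\<And>u. u \<in> N \<inter> M \<Longrightarrow> \<exists>!v. ?sol u v"
    using iv[of UNIV] by auto
  define v where "v u = (THE v. ?sol u v)" for u
  have v: "?sol u (v u)" and v_unique: "?sol u v' \<Longrightarrow> v' = v u" if "u \<in> N \<inter> M" for u v'
    using theI'[OF N(3)[OF that]] the1_equality[OF N(3)[OF that], of v'] by (auto simp: v_def)
  have inN: "eventually (\<lambda>u. u \<in> N' \<inter> M) (at u\<^sub>0 within M)" if "open N'" "u\<^sub>0 \<in> N'" for N'
    using that unfolding eventually_at_topological by blast
  \<comment> \<open>Continuity at \<open>u\<^sub>0\<close>: condition (iv) for balls yields a solution close to \<open>v\<^sub>0\<close>, which by
    global uniqueness is \<open>v u\<close>.\<close>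
  have lim: "(v \<longlongrightarrow> v\<^sub>0) (at u\<^sub>0 within M)"
  proof (rule tendstoI)
    fix \<epsilon> :: real assume "\<epsilon> > 0"
    then obtain N' where N': "open N'" "u\<^sub>0 \<in> N'"
      "\<And>u. u \<in> N' \<inter> M \<Longrightarrow> \<exists>!v. v \<in> ball v\<^sub>0 \<epsilon> \<and> ?sol u v"
      using iv[of "ball v\<^sub>0 \<epsilon>"] by auto
    show "eventually (\<lambda>u. dist (v u) v\<^sub>0 < \<epsilon>) (at u\<^sub>0 within M)"
      using inN[OF N(1,2)] inN[OF N'(1,2)]
    proof eventually_elim
      case (elim u)
      then obtain v' where "v' \<in> ball v\<^sub>0 \<epsilon>" "?sol u v'" using N'(3) by blast
      then show ?case using v_unique[OF elim(1)] by (auto simp: dist_commute)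
    qed
  qed
  have zero: "eventually (\<lambda>u. f (u, v u) = 0) (at u\<^sub>0 within M)"
    using inN[OF N(1,2)] by eventually_elim (use v in blast)
  define r where "r u = max 0 (norm (v u - v\<^sub>0) -
    onorm P * onorm (\<lambda>x. D (x, 0)) * norm (u - u\<^sub>0))" for u
  have r: "r \<in> o[at u\<^sub>0 within M](\<lambda>u. norm (u - u\<^sub>0))"
    using solution_branch_estimate[OF D(1) assms(13) P lim zero] by (simp add: r_def[abs_def])
  have bound: "norm (v\<^sub>1 - v\<^sub>0) \<le> onorm (map_pinv \<phi> \<psi> (jacobian_snd f u\<^sub>0 v\<^sub>0)) *
      onorm (jacobian_fst f u\<^sub>0 v\<^sub>0) * norm (u\<^sub>1 - u\<^sub>0) + r u\<^sub>1"
    if "u\<^sub>1 \<in> N \<inter> M" "?sol u\<^sub>1 v\<^sub>1" for u\<^sub>1 v\<^sub>1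
    using v_unique[OF that] by (simp add: r_def Ju P_def[symmetric])
  show ?thesis
    using N r bound by (intro exI[of _ N] exI[of _ r]) blast
qed

end
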